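(* For every $\epsilon > 0$, the algorithm SSF (shortest slack first), run on a single machine of speed $1+\epsilon$, is $\frac{1}{\epsilon}$-competitive for minimizing the maximum delay factor in unicast scheduling, relative to an optimal offline schedule on a single machine of speed $1$.
   Context: Unicast scheduling: requests $J_i$ arrive online; each has arrival time $a_i$, deadline $d_i$ and processing time $\ell_i$, revealed at time $a_i$, with slack $S_i = d_i - a_i \ge \ell_i$. Preemption is allowed. SSF: at every time $t$, process the unfinished arrived request with the minimum slack. If $f_i$ is the completion time of $J_i$, the delay factor of a schedule on $\sigma$ is $\max\{1,\max_{J_i\in\sigma}(f_i-a_i)/(d_i-a_i)\}$. An algorithm is $s$-speed $r$-competitive if, when given a speed-$s$ machine, its delay factor on every request sequence is at most $r$ times the optimal offline delay factor achievable with a speed-$1$ machine.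
   Formalization: The delay factor is at least 1 by definition, so ratio 1/ε is impossible for ε > 1 (one request with processing time equal to slack); the proved ratio is max{1, 1/ε}, together with (f_i − a_i)/(d_i − a_i) ≤ (1/ε)·OPT for every request and every ε > 0. *)

theory Defs
  imports "HOL-Analysis.Analysis"
begin

record request =
  arrival :: real
  deadline :: real
  proc_time :: real

definition slack :: "request \<Rightarrow> real" where
  "slack J = deadline J - arrival J"

definition valid_sequence :: "request list \<Rightarrow> bool" where
  "valid_sequence \<sigma> \<longleftrightarrow> (\<forall>J\<in>set \<sigma>. 0 < proc_time J \<and> proc_time J \<le> slack J)"

text \<open>
  A preemptive single-machine schedule says, for each time, which request (given by its position
  in the sequence) is being processed, if any.
\<close>

type_synonym schedule = "real \<Rightarrow> nat option"

definition measurable_schedule :: "schedule \<Rightarrow> bool" where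
  "measurable_schedule x \<longleftrightarrow> x \<in> measurable borel (count_space UNIV)"

text \<open>
  The amount of work done on request \<open>i\<close> up to time \<open>t\<close> by a machine of speed \<open>s\<close>.
\<close>

definition processed :: "real \<Rightarrow> schedule \<Rightarrow> nat \<Rightarrow> real \<Rightarrow> real" where
  "processed s x i t = s * measure lborel {u. u \<le> t \<and> x u = Some i}"

definition feasible :: "real \<Rightarrow> request list \<Rightarrow> schedule \<Rightarrow> bool" where
  "feasible s \<sigma> x \<longleftrightarrow>
     measurable_schedule x \<and>
     (\<forall>t i. x t = Some i \<longrightarrow> i < length \<sigma> \<and> arrival (\<sigma> ! i) \<le> t) \<and>
     (\<forall>i<length \<sigma>. \<exists>t. proc_time (\<sigma> ! i) \<le> processed s x i t)"

definition completion_time :: "real \<Rightarrow> request list \<Rightarrow> schedule \<Rightarrow> nat \<Rightarrow> real" where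
  "completion_time s \<sigma> x i = Inf {t. proc_time (\<sigma> ! i) \<le> processed s x i t}"

definition delay_ratio :: "real \<Rightarrow> request list \<Rightarrow> schedule \<Rightarrow> nat \<Rightarrow> real" where
  "delay_ratio s \<sigma> x i =
     (completion_time s \<sigma> x i - arrival (\<sigma> ! i)) / (deadline (\<sigma> ! i) - arrival (\<sigma> ! i))"

definition delay_factor :: "real \<Rightarrow> request list \<Rightarrow> schedule \<Rightarrow> real" where
  "delay_factor s \<sigma> x = Max (insert 1 (delay_ratio s \<sigma> x ` {..<length \<sigma>}))"

definition opt_delay_factor :: "request list \<Rightarrow> real" where
  "opt_delay_factor \<sigma> = (INF x\<in>{x. feasible 1 \<sigma> x}. delay_factor 1 \<sigma> x)"

text \<open>
  An algorithm is given by the schedules it may produce on a machine of the given speed for the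
  given sequence; more than one schedule is possible when ties are broken arbitrarily. To be
  competitive, it must produce some schedule, and each schedule it may produce must complete all
  requests and obey the bound.
\<close>

type_synonym algorithm = "real \<Rightarrow> request list \<Rightarrow> schedule \<Rightarrow> bool"

definition speed_competitive :: "real \<Rightarrow> real \<Rightarrow> algorithm \<Rightarrow> bool" where
  "speed_competitive s r A \<longleftrightarrow>
     (\<forall>\<sigma>. valid_sequence \<sigma> \<longrightarrow>
        (\<exists>x. A s \<sigma> x) \<and>
        (\<forall>x. A s \<sigma> x \<longrightarrow>
           feasible s \<sigma> x \<and> delay_factor s \<sigma> x \<le> r * opt_delay_factor \<sigma>))"

definition pending :: "real \<Rightarrow> request list \<Rightarrow> schedule \<Rightarrow> real \<Rightarrow> nat set" where
  "pending s \<sigma> x t =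
     {i. i < length \<sigma> \<and> arrival (\<sigma> ! i) \<le> t \<and> processed s x i t < proc_time (\<sigma> ! i)}"

definition SSF :: algorithm where
  "SSF s \<sigma> x \<longleftrightarrow>
     measurable_schedule x \<and>
     (\<forall>t. case x t of
            None \<Rightarrow> pending s \<sigma> x t = {}
          | Some i \<Rightarrow> i \<in> pending s \<sigma> x t \<and>
              (\<forall>j\<in>pending s \<sigma> x t. slack (\<sigma> ! i) \<le> slack (\<sigma> ! j)))"

text \<open>
  Since a delay factor is at least 1 by definition, no algorithm has a competitive ratio below 1,
  whatever its speed. A single request without spare slack shows this.
\<close>

lemma delay_factor_ge_1: "1 \<le> delay_factor s \<sigma> x"
  unfolding delay_factor_def by (intro Max_ge) auto

lemma speed_competitive_imp_ge_1:
  assumes "speed_competitive s r A"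
  shows "1 \<le> r"
proof -
  define \<sigma> where "\<sigma> = [\<lparr>arrival = 0, deadline = 1, proc_time = 1\<rparr>]"
  define x :: schedule where "x = (\<lambda>t. if t \<in> {0..1} then Some 0 else None)"
  have valid: "valid_sequence \<sigma>"
    by (simp add: valid_sequence_def \<sigma>_def slack_def)
  have proc: "processed 1 x 0 t = (if t < 0 then 0 else min t 1)" for t
  proof -
    have "{u. u \<le> t \<and> x u = Some 0} = (if t < 0 then {} else {0..min t 1})"
      by (auto simp: x_def)
    then show ?thesis by (auto simp: processed_def)
  qed
  have "measurable_schedule x"
    unfolding measurable_schedule_def x_def by measurable
  moreover have "\<exists>t. 1 \<le> processed 1 x 0 t"
    by (rule exI[of _ 1]) (simp add: proc)
  ultimately have feas: "feasible 1 \<sigma> x"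
    by (auto simp: feasible_def \<sigma>_def x_def split: if_splits)
  have "{t. 1 \<le> processed 1 x 0 t} = {1..}"
    by (auto simp: proc split: if_splits)
  then have "delay_ratio 1 \<sigma> x 0 = 1"
    by (simp add: delay_ratio_def completion_time_def \<sigma>_def)
  then have df: "delay_factor 1 \<sigma> x = 1"
    by (simp add: delay_factor_def \<sigma>_def lessThan_Suc)
  have bdd: "bdd_below (delay_factor 1 \<sigma> ` {x. feasible 1 \<sigma> x})"
    by (rule bdd_belowI[of _ 1]) (auto simp: delay_factor_ge_1)
  have "opt_delay_factor \<sigma> \<le> delay_factor 1 \<sigma> x"
    unfolding opt_delay_factor_def using feas by (intro cINF_lower[OF bdd]) simp
  moreover have "1 \<le> opt_delay_factor \<sigma>"
    unfolding opt_delay_factor_def using feas by (intro cINF_greatest) (auto simp: delay_factor_ge_1)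
  ultimately have "opt_delay_factor \<sigma> = 1"
    using df by simp
  moreover obtain y where "delay_factor s \<sigma> y \<le> r * opt_delay_factor \<sigma>"
    using assms valid unfolding speed_competitive_def by blast
  ultimately show ?thesis
    using delay_factor_ge_1[of s \<sigma> y] by simp
qed

end

theory Submission
  imports Defs
begin

text \<open>
  Let \<open>f\<close> be the completion time of request \<open>i\<close> and \<open>S\<close> its slack. Let \<open>v\<close> be the start of the
  busy period around \<open>i\<close> during which only requests of slack at most \<open>S\<close> are processed. All of
  these arrive in \<open>[v, f)\<close> and SSF does \<open>(1 + \<epsilon>) (f - v)\<close> units of work on them. A
  speed 1 schedule of delay factor \<open>\<alpha>\<close> completes all of them within \<open>[v, f + \<alpha> S]\<close>, hence
  \<open>(1 + \<epsilon>) (f - v) \<le> f + \<alpha> S - v\<close>, that is, \<open>\<epsilon> (f - v) \<le> \<alpha> S\<close>.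
\<close>

section \<open>Time spent inside a set\<close>

definition time_spent :: "real set \<Rightarrow> real \<Rightarrow> real" where
  "time_spent A t = measure lborel (A \<inter> {..t})"

lemma measure_Ioc_Int_le:
  fixes t t' :: real
  assumes "A \<in> sets borel" "t \<le> t'"
  shows "measure lborel (A \<inter> {t<..t'}) \<le> t' - t"
proof -
  have "measure lborel (A \<inter> {t<..t'}) \<le> measure lborel {t<..t'}"
    using assms by (intro measure_mono_fmeasurable) (auto simp: fmeasurable_def)
  then show ?thesis using assms by simp
qed

text \<open>The lower bound keeps every \<open>A \<inter> {..t}\<close> of finite measure. On a set
  of infinite measure \<open>measure\<close> returns 0, and \<open>time_spent\<close> would no
  longer be monotone.\<close>

locale bounded_below_borel_set =
  fixes A :: "real set" and a :: real
  assumes borel: "A \<in> sets borel" and lower: "A \<subseteq> {a..}"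
begin

lemma time_spent_fmeasurable: "A \<inter> {..t} \<in> fmeasurable lborel"
  by (rule fmeasurableI2[of "{a..t}"]) (use borel lower in \<open>auto simp: fmeasurable_def emeasure_lborel_Icc_eq\<close>)

lemma time_spent_add:
  assumes "t \<le> t'"
  shows "time_spent A t' = time_spent A t + measure lborel (A \<inter> {t<..t'})"
proof -
  have eq: "A \<inter> {..t'} = (A \<inter> {..t}) \<union> (A \<inter> {t<..t'})" using assms by auto
  have "A \<inter> {t<..t'} \<in> fmeasurable lborel"
    by (rule fmeasurableI2[of "{t..t'}"]) (use borel in \<open>auto simp: fmeasurable_def emeasure_lborel_Icc_eq\<close>)
  then show ?thesis
    unfolding time_spent_def eq using time_spent_fmeasurable[of t]
    by (intro measure_Union) (auto simp: fmeasurable_def)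
qed

lemma time_spent_mono: "t \<le> t' \<Longrightarrow> time_spent A t \<le> time_spent A t'"
  using time_spent_add by simp

lemma time_spent_lipschitz: "\<bar>time_spent A t - time_spent A t'\<bar> \<le> \<bar>t - t'\<bar>"
proof -
  have "\<bar>time_spent A t - time_spent A t'\<bar> \<le> \<bar>t - t'\<bar>" if "t \<le> t'" for t t'
    using time_spent_add[OF that] measure_Ioc_Int_le[OF borel that] that by simp
  then show ?thesis by (metis abs_minus_commute linear)
qed

lemma time_spent_continuous: "continuous_on S (time_spent A)"
proof (rule lipschitz_on_continuous_on)
  show "1-lipschitz_on S (time_spent A)"
    by (rule lipschitz_onI) (auto simp: dist_real_def time_spent_lipschitz)
qed

lemma time_spent_eq_0:
  assumes "t \<le> a"
  shows "time_spent A t = 0"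
proof -
  have "time_spent A t \<le> measure lborel {a}"
    unfolding time_spent_def
    by (intro measure_mono_fmeasurable) (use assms lower borel in \<open>auto simp: fmeasurable_def\<close>)
  then show ?thesis by (simp add: time_spent_def measure_le_0_iff)
qed

lemma time_spent_attains:
  assumes "0 \<le> c" "c \<le> time_spent A t"
  obtains u where "u \<le> t" "time_spent A u = c"
proof -
  \<comment> \<open>At \<open>min a t\<close> the clock of \<open>A\<close> still reads 0; the
    minimum also covers \<open>t < a\<close>.\<close>
  have "\<exists>u\<ge>min a t. u \<le> t \<and> time_spent A u = c"
    using assms by (intro IVT' time_spent_continuous) (auto simp: time_spent_eq_0)
  then show thesis using that by blast
qed

end

text \<open>If \<open>A\<close> is the time available to a request that needs \<open>c\<close> units
  of machine time, this is the time during which it is served. The strict inequality matches the one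
  in \<open>pending\<close>.\<close>

definition first_portion :: "real set \<Rightarrow> real \<Rightarrow> real set" where
  "first_portion A c = {t \<in> A. time_spent A t < c}"

context bounded_below_borel_set
begin

lemma first_portion_borel: "first_portion A c \<in> sets borel"
proof -
  have [measurable]: "time_spent A \<in> borel_measurable borel"
    by (intro borel_measurable_continuous_onI time_spent_continuous)
  have [measurable]: "A \<in> sets borel" by (rule borel)
  show ?thesis unfolding first_portion_def by measurable
qed

lemma first_portion_bounded_below: "bounded_below_borel_set (first_portion A c) a"
  using first_portion_borel lower by unfold_locales (auto simp: first_portion_def)

text \<open>The two sets agree for as long as the clock of \<open>A\<close> is below
  \<open>c\<close>; from then on the portion gains nothing.\<close>

lemma time_spent_first_portion:
  assumes "0 \<le> c"
  shows "time_spent (first_portion A c) t = min (time_spent A t) c"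
proof -
  interpret P: bounded_below_borel_set "first_portion A c" a
    by (rule first_portion_bounded_below)
  have below: "time_spent (first_portion A c) u = time_spent A u" if "time_spent A u < c" for u
  proof -
    have "first_portion A c \<inter> {..u} = A \<inter> {..u}"
      using that time_spent_mono[of _ u] by (fastforce simp: first_portion_def)
    then show ?thesis by (simp add: time_spent_def)
  qed
  show ?thesis
  proof (cases "time_spent A t < c")
    case True
    then show ?thesis by (simp add: below)
  next
    case False
    then have ge: "c \<le> time_spent A t" by simp
    \<comment> \<open>After \<open>u\<close> the clock reads at least \<open>c\<close>, so the whole
      portion lies in \<open>{..u}\<close>.\<close>
    obtain u where u: "time_spent A u = c" using time_spent_attains[OF assms ge] by blast
    have "first_portion A c \<inter> {..t} \<subseteq> A \<inter> {..u}"
    proof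
      fix w assume "w \<in> first_portion A c \<inter> {..t}"
      then show "w \<in> A \<inter> {..u}"
        using u time_spent_mono[of u w] by (cases "w \<le> u") (auto simp: first_portion_def)
    qed
    then have "time_spent (first_portion A c) t \<le> time_spent A u"
      unfolding time_spent_def
      by (intro measure_mono_fmeasurable time_spent_fmeasurable)
         (use first_portion_borel[of c] in auto)
    then have "time_spent (first_portion A c) t \<le> c" using u by simp
    moreover have "c \<le> time_spent (first_portion A c) t"
    \<comment> \<open>The agreement in \<open>below\<close> needs a clock value strictly less than
      \<open>c\<close>, so \<open>c\<close> is approached from below.\<close>
    proof (rule dense_le)
      fix d assume "d < c"
      show "d \<le> time_spent (first_portion A c) t"
      proof (cases "d \<le> 0")
        case True
        then show ?thesis
          unfolding time_spent_def by (rule order_trans[OF _ measure_nonneg])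
      next
        case False
        then obtain v where v: "v \<le> t" "time_spent A v = d"
          using time_spent_attains[of d t] ge \<open>d < c\<close> by auto
        then show ?thesis using below[of v] \<open>d < c\<close> P.time_spent_mono[of v t] by simp
      qed
    qed
    ultimately show ?thesis using ge by simp
  qed
qed

end

section \<open>Schedules that respect arrival times\<close>

text \<open>Common ground of the SSF schedule and of the speed 1 schedule it is compared with. The
  arrival condition bounds the time set of each request from below.\<close>

locale causal_schedule =
  fixes s :: real and \<sigma> :: "request list" and x :: schedule
  assumes speed_pos: "0 < s"
    and measurable_x: "measurable_schedule x"
    and runs: "\<And>t i. x t = Some i \<Longrightarrow> i < length \<sigma> \<and> arrival (\<sigma> ! i) \<le> t"
begin

lemma processed_eq: "processed s x i t = s * time_spent {u. x u = Some i} t"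
  unfolding processed_def time_spent_def by (simp add: Int_def conj_commute)

lemma run_borel: "{u. x u = Some i} \<in> sets borel"
proof -
  have "x -` {Some i} \<inter> space borel \<in> sets borel"
    using measurable_x unfolding measurable_schedule_def by (rule measurable_sets) simp
  then show ?thesis by (simp add: vimage_def)
qed

sublocale run: bounded_below_borel_set "{u. x u = Some i}" "arrival (\<sigma> ! i)" for i
  using run_borel runs by unfold_locales auto

lemma processed_mono: "t \<le> t' \<Longrightarrow> processed s x i t \<le> processed s x i t'"
  using speed_pos by (simp add: processed_eq run.time_spent_mono)

lemma processed_eq_0: "t \<le> arrival (\<sigma> ! i) \<Longrightarrow> processed s x i t = 0"
  by (simp add: processed_eq run.time_spent_eq_0)

lemma processed_add:
  "t \<le> t' \<Longrightarrow> processed s x i t' =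
    processed s x i t + s * measure lborel ({u. x u = Some i} \<inter> {t<..t'})"
  by (simp add: processed_eq run.time_spent_add algebra_simps)

text \<open>A schedule is a function of time, so the time sets of different requests are disjoint
  and their measures add up.\<close>

lemma sum_measure_runs:
  assumes "finite K"
  shows "(\<Sum>i\<in>K. measure lborel ({u. x u = Some i} \<inter> {t<..t'})) =
    measure lborel ({u. x u \<in> Some ` K} \<inter> {t<..t'})"
proof -
  have eq: "{u. x u \<in> Some ` K} \<inter> {t<..t'} = (\<Union>i\<in>K. {u. x u = Some i} \<inter> {t<..t'})"
    by auto
  have fm: "{u. x u = Some i} \<inter> {t<..t'} \<in> fmeasurable lborel" for i
    by (rule fmeasurableI2[of "{t..t'}"]) (use run_borel in \<open>auto simp: fmeasurable_def emeasure_lborel_Icc_eq\<close>)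
  show ?thesis
    unfolding eq
  proof (rule measure_finite_Union[symmetric])
    show "(\<lambda>i. {u. x u = Some i} \<inter> {t<..t'}) ` K \<subseteq> sets lborel" using fm by blast
    show "emeasure lborel ({u. x u = Some i} \<inter> {t<..t'}) \<noteq> \<infinity>" for i
      using fmeasurableD2[OF fm] by simp
  qed (use assms in \<open>auto simp: disjoint_family_on_def\<close>)
qed

lemma runs_borel: "finite K \<Longrightarrow> {u. x u \<in> Some ` K} \<in> sets borel"
proof -
  assume "finite K"
  have "{u. x u \<in> Some ` K} = (\<Union>i\<in>K. {u. x u = Some i})" by auto
  then show ?thesis using \<open>finite K\<close> run_borel by auto
qed

text \<open>The capacity of a single machine; this limits the speed 1 schedule, while the converse
  bound below measures what SSF achieves in a busy period.\<close>

lemma sum_measure_runs_le: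
  assumes "finite K" "t \<le> t'"
  shows "(\<Sum>i\<in>K. measure lborel ({u. x u = Some i} \<inter> {t<..t'})) \<le> t' - t"
  unfolding sum_measure_runs[OF assms(1)]
  by (rule measure_Ioc_Int_le[OF runs_borel[OF assms(1)] assms(2)])

lemma sum_measure_runs_ge:
  assumes "finite K" "t \<le> t'" and busy: "\<And>u. t < u \<Longrightarrow> u < t' \<Longrightarrow> x u \<in> Some ` K"
  shows "t' - t \<le> (\<Sum>i\<in>K. measure lborel ({u. x u = Some i} \<inter> {t<..t'}))"
proof -
  have "{u. x u \<in> Some ` K} \<inter> {t<..t'} \<in> fmeasurable lborel"
    by (rule fmeasurableI2[of "{t..t'}"])
       (use runs_borel[OF assms(1)] in \<open>auto simp: fmeasurable_def emeasure_lborel_Icc_eq\<close>)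
  then have "measure lborel {t<..<t'} \<le> measure lborel ({u. x u \<in> Some ` K} \<inter> {t<..t'})"
    using busy by (intro measure_mono_fmeasurable) auto
  then show ?thesis using assms by (simp add: sum_measure_runs)
qed

lemma completion_set_bdd_below:
  assumes "0 < proc_time (\<sigma> ! i)"
  shows "proc_time (\<sigma> ! i) \<le> processed s x i t \<Longrightarrow> arrival (\<sigma> ! i) \<le> t"
    and "bdd_below {t. proc_time (\<sigma> ! i) \<le> processed s x i t}"
proof -
  show *: "arrival (\<sigma> ! i) \<le> t" if "proc_time (\<sigma> ! i) \<le> processed s x i t" for t
    using that assms processed_eq_0[of t i] by (cases "arrival (\<sigma> ! i) \<le> t") auto
  show "bdd_below {t. proc_time (\<sigma> ! i) \<le> processed s x i t}"
    by (rule bdd_belowI[of _ "arrival (\<sigma> ! i)"]) (use * in auto)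
qed

lemma processed_before_completion:
  assumes "0 < proc_time (\<sigma> ! i)" "t < completion_time s \<sigma> x i"
  shows "processed s x i t < proc_time (\<sigma> ! i)"
  using assms completion_set_bdd_below(2)[OF assms(1)] cInf_lower[of t]
  unfolding completion_time_def by (metis linorder_not_less mem_Collect_eq)

text \<open>The work done is continuous in time, so the set of times at which the request is
  finished is closed and contains its infimum.\<close>

lemma processed_at_completion:
  assumes "0 < proc_time (\<sigma> ! i)" "\<exists>t. proc_time (\<sigma> ! i) \<le> processed s x i t"
  shows "proc_time (\<sigma> ! i) \<le> processed s x i (completion_time s \<sigma> x i)"
proof -
  have "continuous_on UNIV (processed s x i)"
    unfolding processed_eq[abs_def] by (intro continuous_intros run.time_spent_continuous)
  then have "closed {t. proc_time (\<sigma> ! i) \<le> processed s x i t}"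
    by (intro closed_Collect_le continuous_intros) auto
  then have "completion_time s \<sigma> x i \<in> {t. proc_time (\<sigma> ! i) \<le> processed s x i t}"
    unfolding completion_time_def
    using assms completion_set_bdd_below(2) by (intro closed_contains_Inf) auto
  then show ?thesis by simp
qed

end

lemma feasible_causal: "0 < s \<Longrightarrow> feasible s \<sigma> x \<Longrightarrow> causal_schedule s \<sigma> x"
  unfolding feasible_def by unfold_locales auto

section \<open>Shortest slack first\<close>

locale SSF_schedule =
  fixes s :: real and \<sigma> :: "request list" and x :: schedule
  assumes speed_pos: "0 < s" and SSF: "SSF s \<sigma> x" and valid: "valid_sequence \<sigma>"
begin

lemma pending_run: "x t = Some i \<Longrightarrow> i \<in> pending s \<sigma> x t"
  and min_slack_run: "x t = Some i \<Longrightarrow> j \<in> pending s \<sigma> x t \<Longrightarrow> slack (\<sigma> ! i) \<le> slack (\<sigma> ! j)"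
  and busy_if_pending: "j \<in> pending s \<sigma> x t \<Longrightarrow> \<exists>i. x t = Some i"
  using SSF unfolding SSF_def by (force split: option.splits dest!: spec[of _ t])+

sublocale causal_schedule s \<sigma> x
  using speed_pos SSF pending_run by unfold_locales (auto simp: SSF_def pending_def)

lemma proc_time_pos: "i < length \<sigma> \<Longrightarrow> 0 < proc_time (\<sigma> ! i)"
  using valid by (auto simp: valid_sequence_def)

lemma slack_pos: "i < length \<sigma> \<Longrightarrow> 0 < slack (\<sigma> ! i)"
  using valid by (meson less_le_trans nth_mem valid_sequence_def)

text \<open>SSF runs a request only while it is unfinished, so the time set of the request is its
  own first portion and its clock is capped.\<close>

lemma processed_le_proc_time:
  assumes "i < length \<sigma>"
  shows "processed s x i t \<le> proc_time (\<sigma> ! i)"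
proof -
  let ?A = "{u. x u = Some i}" and ?c = "proc_time (\<sigma> ! i) / s"
  have "time_spent ?A u < ?c" if "x u = Some i" for u
    using pending_run[OF that] speed_pos
    by (simp add: pending_def processed_eq field_simps)
  then have "first_portion ?A ?c = ?A" by (auto simp: first_portion_def)
  then have "time_spent ?A t = min (time_spent ?A t) ?c"
    using run.time_spent_first_portion[of ?c i t] speed_pos proc_time_pos[OF assms] by simp
  then show ?thesis using speed_pos by (simp add: processed_eq field_simps min_def split: if_splits)
qed

text \<open>A request that stayed pending forever would keep the machine busy forever, but the total
  work of all requests is finite.\<close>

lemma finishes:
  assumes i: "i < length \<sigma>"
  shows "\<exists>t. proc_time (\<sigma> ! i) \<le> processed s x i t"
proof (rule ccontr)
  assume "\<not> ?thesis"
  then have pend: "i \<in> pending s \<sigma> x t" if "arrival (\<sigma> ! i) \<le> t" for t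
    using that i by (auto simp: pending_def not_le)
  define K where "K = {..<length \<sigma>}"
  define L where "L = (\<Sum>j\<in>K. proc_time (\<sigma> ! j))"
  define t where "t = arrival (\<sigma> ! i)"
  \<comment> \<open>Long enough for \<open>L + s\<close> units of work, more than all requests
    contain.\<close>
  define t' where "t' = t + L / s + 1"
  have "0 \<le> L" unfolding L_def K_def by (intro sum_nonneg) (auto dest: proc_time_pos)
  then have le: "t \<le> t'" using speed_pos by (simp add: t'_def)
  have "x u \<in> Some ` K" if "t < u" "u < t'" for u
    using busy_if_pending[OF pend[of u]] that runs by (auto simp: t_def K_def)
  then have "t' - t \<le> (\<Sum>j\<in>K. measure lborel ({u. x u = Some j} \<inter> {t<..t'}))"
    using le by (intro sum_measure_runs_ge) (auto simp: K_def)
  then have "s * (t' - t) \<le> (\<Sum>j\<in>K. s * measure lborel ({u. x u = Some j} \<inter> {t<..t'}))"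
    using speed_pos by (simp add: sum_distrib_left[symmetric])
  also have "\<dots> \<le> L"
    unfolding L_def
  proof (rule sum_mono)
    fix j assume "j \<in> K"
    moreover have "0 \<le> processed s x j t"
      using speed_pos by (simp add: processed_def)
    ultimately show "s * measure lborel ({u. x u = Some j} \<inter> {t<..t'}) \<le> proc_time (\<sigma> ! j)"
      using processed_add[OF le, of j] processed_le_proc_time[of j t'] by (simp add: K_def)
  qed
  finally show False using speed_pos by (simp add: t'_def algebra_simps)
qed

lemma feasible: "feasible s \<sigma> x"
  unfolding feasible_def using measurable_x runs finishes by blast

text \<open>
  Going back from the completion of \<open>i\<close>, the busy period with respect to the requests of slack at
  most that of \<open>i\<close> begins at an arrival time; the latest arrival time not after that of \<open>i\<close> at
  which nothing older is left over is such a starting point.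
\<close>

lemma busy_period:
  assumes i: "i < length \<sigma>"
  defines "H \<equiv> {j. j < length \<sigma> \<and> slack (\<sigma> ! j) \<le> slack (\<sigma> ! i)}"
  obtains v where "v \<le> arrival (\<sigma> ! i)"
    and "\<forall>j\<in>H. arrival (\<sigma> ! j) < v \<longrightarrow> proc_time (\<sigma> ! j) \<le> processed s x j v"
    and "\<forall>u\<in>{v..<completion_time s \<sigma> x i}. H \<inter> pending s \<sigma> x u \<noteq> {}"
proof -
  let ?a = "\<lambda>j. arrival (\<sigma> ! j)"
  define A where "A = {?a j | j. j \<in> H \<and> ?a j \<le> ?a i}"
  define clean where
    "clean v \<longleftrightarrow> (\<forall>j\<in>H. ?a j < v \<longrightarrow> proc_time (\<sigma> ! j) \<le> processed s x j v)" for v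
  define v where "v = Max {w \<in> A. clean w}"
  have iH: "i \<in> H" using i by (simp add: H_def)
  have finA: "finite A" unfolding A_def H_def by auto
  have aiA: "?a i \<in> A" using iH by (auto simp: A_def)
  \<comment> \<open>No request of \<open>H\<close> arrives before \<open>Min A\<close>, as its
    arrival time would itself belong to \<open>A\<close>.\<close>
  have "clean (Min A)"
    unfolding clean_def
  proof (intro ballI impI)
    fix j assume j: "j \<in> H" "?a j < Min A"
    then have "?a j \<in> A" using Min_le[OF finA aiA] by (auto simp: A_def)
    then show "proc_time (\<sigma> ! j) \<le> processed s x j (Min A)" using Min_le[OF finA] j by force
  qed
  moreover have "Min A \<in> A" using finA aiA by (intro Min_in) auto
  ultimately have ne: "{w \<in> A. clean w} \<noteq> {}" by blast
  have v: "v \<in> A" "clean v" using Max_in[OF _ ne] finA unfolding v_def by auto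
  have vmax: "w \<le> v" if "w \<in> A" "clean w" for w
    unfolding v_def using that finA by (intro Max_ge) auto
  show thesis
  proof (rule that[of v])
    show "v \<le> ?a i" using v(1) by (auto simp: A_def)
    show "\<forall>j\<in>H. ?a j < v \<longrightarrow> proc_time (\<sigma> ! j) \<le> processed s x j v"
      using v(2) by (simp add: clean_def)
    show "\<forall>u\<in>{v..<completion_time s \<sigma> x i}. H \<inter> pending s \<sigma> x u \<noteq> {}"
    proof (intro ballI notI)
      fix u assume "u \<in> {v..<completion_time s \<sigma> x i}"
      then have u: "v \<le> u" "u < completion_time s \<sigma> x i" by auto
      assume empty: "H \<inter> pending s \<sigma> x u = {}"
      have fin: "proc_time (\<sigma> ! j) \<le> processed s x j u" if "j \<in> H" "?a j \<le> u" for j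
        using empty that by (auto simp: pending_def H_def not_less)
      \<comment> \<open>Before its completion time \<open>i\<close> is unfinished, so if it is not
        pending it has not arrived.\<close>
      have "u < ?a i"
        using fin[OF iH] processed_before_completion[OF proc_time_pos[OF i] u(2)] by fastforce
      \<comment> \<open>Requests of \<open>H\<close> arriving before the next arrival time
        \<open>w\<close> have arrived by \<open>u\<close> and are finished. Hence \<open>w\<close>
        is clean and later than \<open>v\<close>, against the choice of \<open>v\<close>.\<close>
      define w where "w = Min {w \<in> A. u < w}"
      have "w \<in> {w \<in> A. u < w}"
        unfolding w_def using finA aiA \<open>u < ?a i\<close> by (intro Min_in) auto
      then have w: "w \<in> A" "u < w" by auto
      have wmin: "w \<le> w'" if "w' \<in> A" "u < w'" for w'
        unfolding w_def using that finA by (intro Min_le) auto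
      have "clean w"
        unfolding clean_def
      proof (intro ballI impI)
        fix j assume j: "j \<in> H" "?a j < w"
        then have "?a j \<in> A" using w(1) by (auto simp: A_def)
        then have "?a j \<le> u" using wmin j(2) by (meson linorder_not_less)
        then show "proc_time (\<sigma> ! j) \<le> processed s x j w"
          using fin[OF j(1)] processed_mono[of u w j] w(2) by linarith
      qed
      then show False using vmax[OF w(1)] w(2) u(1) by simp
    qed
  qed
qed

text \<open>Stated against an arbitrary feasible \<open>y\<close>, because
  \<open>opt_delay_factor\<close> is an infimum that need not be known to be attained.\<close>

lemma completion_time_bound:
  assumes i: "i < length \<sigma>" and y: "feasible 1 \<sigma> y" and "1 \<le> s"
  shows "(s - 1) * (completion_time s \<sigma> x i - arrival (\<sigma> ! i)) \<le>
    delay_factor 1 \<sigma> y * slack (\<sigma> ! i)"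
proof -
  interpret Y: causal_schedule 1 \<sigma> y using y by (intro feasible_causal) auto
  define H where "H = {j. j < length \<sigma> \<and> slack (\<sigma> ! j) \<le> slack (\<sigma> ! i)}"
  define f where "f = completion_time s \<sigma> x i"
  define \<alpha> where "\<alpha> = delay_factor 1 \<sigma> y"
  obtain v where va: "v \<le> arrival (\<sigma> ! i)"
    and old: "\<forall>j\<in>H. arrival (\<sigma> ! j) < v \<longrightarrow> proc_time (\<sigma> ! j) \<le> processed s x j v"
    and pend: "\<forall>u\<in>{v..<f}. H \<inter> pending s \<sigma> x u \<noteq> {}"
    by (rule busy_period[OF i, folded H_def f_def])
  define K where "K = {j \<in> H. v \<le> arrival (\<sigma> ! j) \<and> arrival (\<sigma> ! j) < f}"
  \<comment> \<open>Requests of \<open>K\<close> arrive before \<open>f\<close> and have slack at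
    most that of \<open>i\<close>, so \<open>y\<close> completes them all by
    \<open>T\<close>.\<close>
  define T where "T = f + \<alpha> * slack (\<sigma> ! i)"
  have finK: "finite K" by (simp add: K_def H_def)
  have "arrival (\<sigma> ! i) \<le> f"
    unfolding f_def
    using processed_at_completion[OF proc_time_pos[OF i] finishes[OF i]]
    by (rule completion_set_bdd_below(1)[OF proc_time_pos[OF i]])
  then have vf: "v \<le> f" using va by simp
  have \<alpha>: "1 \<le> \<alpha>" unfolding \<alpha>_def by (rule delay_factor_ge_1)
  then have "f \<le> T" using slack_pos[OF i] by (simp add: T_def)
  have "x u \<in> Some ` K" if u: "v < u" "u < f" for u
  proof -
    obtain h where h: "h \<in> H" "h \<in> pending s \<sigma> x u" using pend u by fastforce
    obtain j where j: "x u = Some j" using busy_if_pending[OF h(2)] by blast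
    have jH: "j \<in> H"
      using min_slack_run[OF j h(2)] h(1) runs[OF j] by (auto simp: H_def)
    \<comment> \<open>A request still run at \<open>u\<close> was unfinished at \<open>v\<close>, so
      by \<open>old\<close> it cannot have arrived before \<open>v\<close>.\<close>
    have "processed s x j v < proc_time (\<sigma> ! j)"
      using pending_run[OF j] processed_mono[of v u j] u by (auto simp: pending_def)
    then have "v \<le> arrival (\<sigma> ! j)" using old jH by force
    then have "j \<in> K" using jH runs[OF j] u by (simp add: K_def)
    then show ?thesis using j by blast
  qed
  then have "f - v \<le> (\<Sum>j\<in>K. measure lborel ({u. x u = Some j} \<inter> {v<..f}))"
    using vf finK by (intro sum_measure_runs_ge)
  then have "s * (f - v) \<le> (\<Sum>j\<in>K. s * measure lborel ({u. x u = Some j} \<inter> {v<..f}))"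
    using speed_pos by (simp add: sum_distrib_left[symmetric])
  also have "\<dots> \<le> (\<Sum>j\<in>K. measure lborel ({u. y u = Some j} \<inter> {v<..T}))"
  proof (rule sum_mono)
    fix j assume "j \<in> K"
    then have j: "j < length \<sigma>" "slack (\<sigma> ! j) \<le> slack (\<sigma> ! i)" "v \<le> arrival (\<sigma> ! j)"
      "arrival (\<sigma> ! j) < f" by (auto simp: K_def H_def)
    have "s * measure lborel ({u. x u = Some j} \<inter> {v<..f}) \<le> proc_time (\<sigma> ! j)"
      using processed_add[OF vf, of j] processed_le_proc_time[OF j(1), of f]
        processed_eq_0[OF j(3)] by simp
    also have "\<dots> \<le> processed 1 y j (completion_time 1 \<sigma> y j)"
      using y j(1) by (intro Y.processed_at_completion proc_time_pos) (auto simp: feasible_def)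
    also have "\<dots> \<le> processed 1 y j T"
    proof (rule Y.processed_mono)
      have "delay_ratio 1 \<sigma> y j \<le> \<alpha>"
        unfolding \<alpha>_def delay_factor_def using j(1) by (intro Max_ge) auto
      then have "completion_time 1 \<sigma> y j - arrival (\<sigma> ! j) \<le> \<alpha> * slack (\<sigma> ! j)"
        using slack_pos[OF j(1)] by (simp add: delay_ratio_def slack_def pos_divide_le_eq)
      also have "\<dots> \<le> \<alpha> * slack (\<sigma> ! i)" using j(2) \<alpha> by (intro mult_left_mono) auto
      finally show "completion_time 1 \<sigma> y j \<le> T" using j(4) by (simp add: T_def)
    qed
    \<comment> \<open>Since \<open>j\<close> arrives no earlier than \<open>v\<close>, all work of
      \<open>y\<close> on it up to \<open>T\<close> falls after \<open>v\<close>.\<close>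
    also have "\<dots> = measure lborel ({u. y u = Some j} \<inter> {v<..T})"
      using Y.processed_add[of v T j] vf \<open>f \<le> T\<close> Y.processed_eq_0[OF j(3)] by simp
    finally show "s * measure lborel ({u. x u = Some j} \<inter> {v<..f}) \<le>
      measure lborel ({u. y u = Some j} \<inter> {v<..T})" .
  qed
  also have "\<dots> \<le> T - v" using finK vf \<open>f \<le> T\<close> by (intro Y.sum_measure_runs_le) auto
  finally have "(s - 1) * (f - v) \<le> \<alpha> * slack (\<sigma> ! i)" by (simp add: T_def algebra_simps)
  moreover have "(s - 1) * (f - arrival (\<sigma> ! i)) \<le> (s - 1) * (f - v)"
    using va \<open>1 \<le> s\<close> by (intro mult_left_mono) auto
  ultimately show "(s - 1) * (completion_time s \<sigma> x i - arrival (\<sigma> ! i)) \<le>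
    delay_factor 1 \<sigma> y * slack (\<sigma> ! i)"
    by (simp add: f_def \<alpha>_def)
qed

end

section \<open>Existence of an SSF schedule\<close>

text \<open>
  Requests are served in a fixed order \<open>p\<close> of priority: each one receives the first portion of the
  time that the requests of higher priority leave to it. \<open>busy_set s \<sigma> p k\<close> is the time used by
  the first \<open>k\<close> requests of \<open>p\<close>.
\<close>

fun busy_set :: "real \<Rightarrow> request list \<Rightarrow> nat list \<Rightarrow> nat \<Rightarrow> real set" where
  "busy_set s \<sigma> p 0 = {}"
| "busy_set s \<sigma> p (Suc k) = busy_set s \<sigma> p k \<union>
    first_portion ({arrival (\<sigma> ! (p ! k))..} - busy_set s \<sigma> p k) (proc_time (\<sigma> ! (p ! k)) / s)"

lemma busy_set_borel: "busy_set s \<sigma> p k \<in> sets borel"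
proof (induction k)
  case (Suc k)
  interpret bounded_below_borel_set "{arrival (\<sigma> ! (p ! k))..} - busy_set s \<sigma> p k"
    "arrival (\<sigma> ! (p ! k))"
    using Suc by unfold_locales auto
  show ?case using Suc first_portion_borel by auto
qed simp

lemma busy_set_mono: "k \<le> m \<Longrightarrow> busy_set s \<sigma> p k \<subseteq> busy_set s \<sigma> p m"
  by (rule lift_Suc_mono_le[of "busy_set s \<sigma> p"]) auto

text \<open>The SSF condition refers to the past of the schedule itself. Slacks do not change with
  time, so sorting by slack breaks this circularity: the time left to a request depends only on
  those ranked above it.\<close>

lemma SSF_exists:
  assumes valid: "valid_sequence \<sigma>" and "0 < s"
  shows "\<exists>x. SSF s \<sigma> x"
proof -
  define n where "n = length \<sigma>"
  define p where "p = sort_key (\<lambda>i. slack (\<sigma> ! i)) [0..<n]"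
  define B where "B = busy_set s \<sigma> p"
  define free where "free k = {arrival (\<sigma> ! (p ! k))..} - B k" for k
  define R where "R k = first_portion (free k) (proc_time (\<sigma> ! (p ! k)) / s)" for k
  \<comment> \<open>The sets \<open>B k\<close> increase, so the least \<open>k\<close> is the rank
    whose increment \<open>R k\<close> contains \<open>t\<close>.\<close>
  define x :: schedule where
    "x t = (if t \<in> B n then Some (p ! (LEAST k. t \<in> B (Suc k))) else None)" for t
  have len: "length p = n" and setp: "set p = {..<n}" and dist: "distinct p"
    by (auto simp: p_def)
  have sorted: "slack (\<sigma> ! (p ! k)) \<le> slack (\<sigma> ! (p ! m))" if "k \<le> m" "m < n" for k m
  proof -
    have "sorted (map (\<lambda>i. slack (\<sigma> ! i)) p)" by (simp add: p_def)
    from sorted_nth_mono[OF this that(1)] show ?thesis using that len by simp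
  qed
  have B0: "B 0 = {}" and BSuc: "B (Suc k) = B k \<union> R k" for k
    by (auto simp: B_def R_def free_def)
  have Bmono: "B k \<subseteq> B m" if "k \<le> m" for k m
    using busy_set_mono[OF that] by (simp add: B_def)
  have RB: "R k \<inter> B k = {}" for k by (auto simp: R_def free_def first_portion_def)
  have in_R: "\<exists>k<m. t \<in> R k" if "t \<in> B m" for t m
    using that by (induction m) (auto simp: B0 BSuc less_Suc_eq)
  have free_set: "bounded_below_borel_set (free k) (arrival (\<sigma> ! (p ! k)))" for k
    using busy_set_borel[of s \<sigma> p k] by unfold_locales (auto simp: free_def B_def)
  have R_borel: "R k \<in> sets borel" for k
    unfolding R_def by (rule bounded_below_borel_set.first_portion_borel[OF free_set])
  have x_R: "x t = Some (p ! k)" if k: "k < n" "t \<in> R k" for t k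
  proof -
    have "t \<notin> B (Suc m)" if "m < k" for m
      using RB[of k] k(2) Bmono[of "Suc m" k] that by auto
    moreover have "t \<in> B (Suc k)" using k(2) BSuc by blast
    ultimately have "(LEAST k. t \<in> B (Suc k)) = k"
      by (metis Least_equality linorder_not_less)
    moreover have "t \<in> B n" using \<open>t \<in> B (Suc k)\<close> Bmono[of "Suc k" n] k(1) by auto
    ultimately show ?thesis by (simp add: x_def)
  qed
  have x_cases: "x t = None \<and> t \<notin> B n \<or> (\<exists>k<n. t \<in> R k \<and> x t = Some (p ! k))" for t
    using in_R[of t n] x_R[of _ t] by (cases "t \<in> B n") (auto simp: x_def)
  have run_eq: "{t. x t = Some (p ! k)} = R k" if "k < n" for k
  proof (intro equalityI subsetI)
    fix t assume "t \<in> {t. x t = Some (p ! k)}"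
    then obtain m where "m < n" "t \<in> R m" "p ! k = p ! m" using x_cases[of t] by auto
    then show "t \<in> R k" using nth_eq_iff_index_eq[OF dist] len that by simp
  qed (use x_R that in simp)
  have pn: "p ! k < n" if "k < n" for k using setp len that nth_mem by blast
  have ex_k: "\<exists>k<n. i = p ! k" if "i < n" for i
    using setp len that by (metis in_set_conv_nth lessThan_iff)
  have meas: "measurable_schedule x"
    unfolding measurable_schedule_def
  proof (subst measurable_count_space_eq2_countable, safe)
    fix c :: "nat option"
    have "x -` {c} \<in> sets borel"
    proof (cases c)
      case None
      have "x -` {c} = UNIV - B n" unfolding None by (auto simp: x_def)
      then show ?thesis using busy_set_borel[of s \<sigma> p n] by (auto simp: B_def)
    next
      case (Some i)
      show ?thesis
      proof (cases "i < n")
        case True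
        then obtain k where "k < n" "i = p ! k" using ex_k by blast
        then have "x -` {c} = R k" using run_eq[of k] Some by auto
        then show ?thesis using R_borel by simp
      next
        case False
        then have "x t \<noteq> c" for t using x_cases[of t] pn Some by auto
        then have "x -` {c} = {}" by auto
        then show ?thesis by simp
      qed
    qed
    then show "x -` {c} \<inter> space borel \<in> sets borel" by simp
  qed auto
  have proc: "processed s x (p ! k) t = s * min (time_spent (free k) t) (proc_time (\<sigma> ! (p ! k)) / s)"
    if "k < n" for k t
  proof -
    have "processed s x (p ! k) t = s * time_spent (R k) t"
      unfolding processed_def time_spent_def run_eq[OF that, symmetric]
      by (simp add: Int_def conj_commute)
    moreover have "0 < proc_time (\<sigma> ! (p ! k))"
      using valid pn[OF that] by (simp add: valid_sequence_def n_def)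
    then have "0 \<le> proc_time (\<sigma> ! (p ! k)) / s" using \<open>0 < s\<close> by simp
    ultimately show ?thesis
      unfolding R_def by (simp add: bounded_below_borel_set.time_spent_first_portion[OF free_set])
  qed
  have pend: "p ! k \<in> pending s \<sigma> x t \<longleftrightarrow>
      arrival (\<sigma> ! (p ! k)) \<le> t \<and> time_spent (free k) t < proc_time (\<sigma> ! (p ! k)) / s"
    if "k < n" for k t
    using pn[OF that] \<open>0 < s\<close>
    by (auto simp: pending_def n_def proc[OF that] min_def field_simps)
  \<comment> \<open>A pending request is either served or displaced by one ranked above it. Hence
    the machine never idles while work is pending, and no pending request outranks the one
    served.\<close>
  have pend_R: "t \<in> B (Suc k)" if "k < n" "p ! k \<in> pending s \<sigma> x t" for k t
    using that by (auto simp: pend BSuc R_def free_def first_portion_def)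
  have "SSF s \<sigma> x"
    unfolding SSF_def
  proof (intro conjI meas allI)
    fix t
    from x_cases[of t] show "case x t of
            None \<Rightarrow> pending s \<sigma> x t = {}
          | Some i \<Rightarrow> i \<in> pending s \<sigma> x t \<and>
              (\<forall>j\<in>pending s \<sigma> x t. slack (\<sigma> ! i) \<le> slack (\<sigma> ! j))"
    proof (elim disjE conjE exE)
      assume none: "x t = None" "t \<notin> B n"
      have "i \<notin> pending s \<sigma> x t" for i
      proof
        assume i: "i \<in> pending s \<sigma> x t"
        then obtain k where "k < n" "i = p ! k" using ex_k by (auto simp: pending_def n_def)
        then show False using pend_R[of k t] i none(2) Bmono[of "Suc k" n] by auto
      qed
      then show ?thesis using none by auto
    next
      fix k assume k: "k < n" "t \<in> R k" "x t = Some (p ! k)"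
      have "p ! k \<in> pending s \<sigma> x t"
        using k(2) by (auto simp: pend[OF k(1)] R_def free_def first_portion_def)
      moreover have "slack (\<sigma> ! (p ! k)) \<le> slack (\<sigma> ! j)" if j: "j \<in> pending s \<sigma> x t" for j
      proof -
        obtain m where m: "m < n" "j = p ! m" using ex_k j by (auto simp: pending_def n_def)
        then have "t \<in> B (Suc m)" using pend_R[of m t] j by simp
        then have "\<not> Suc m \<le> k" using RB[of k] k(2) Bmono[of "Suc m" k] by auto
        then show ?thesis using sorted[of k m] m by simp
      qed
      ultimately show ?thesis using k(3) by simp
    qed
  qed
  then show ?thesis by blast
qed

section \<open>Competitiveness\<close>

text \<open>SSF itself is a witness. At speed 1 this makes the infimum in
  \<open>opt_delay_factor\<close> range over a nonempty set.\<close>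

lemma feasible_exists:
  assumes "valid_sequence \<sigma>" "0 < s"
  shows "\<exists>x. feasible s \<sigma> x"
  using SSF_exists[OF assms] assms SSF_schedule.feasible[of s \<sigma>] unfolding SSF_schedule_def by blast

lemma opt_delay_factor_ge_1: "valid_sequence \<sigma> \<Longrightarrow> 1 \<le> opt_delay_factor \<sigma>"
  unfolding opt_delay_factor_def using feasible_exists[of \<sigma> 1]
  by (intro cINF_greatest) (auto simp: delay_factor_ge_1)

lemma SSF_delay_ratio_le:
  assumes "\<epsilon> > 0" "valid_sequence \<sigma>" "SSF (1 + \<epsilon>) \<sigma> x" "i < length \<sigma>"
  shows "delay_ratio (1 + \<epsilon>) \<sigma> x i \<le> 1 / \<epsilon> * opt_delay_factor \<sigma>"
proof -
  interpret SSF_schedule "1 + \<epsilon>" \<sigma> x using assms by unfold_locales auto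
  have slack: "0 < slack (\<sigma> ! i)" using assms(4) by (rule slack_pos)
  \<comment> \<open>With \<epsilon> on the left, the bound against each single \<open>y\<close>
    passes directly to the infimum.\<close>
  have "\<epsilon> * delay_ratio (1 + \<epsilon>) \<sigma> x i \<le> opt_delay_factor \<sigma>"
    unfolding opt_delay_factor_def
  proof (rule cINF_greatest)
    show "{y. feasible 1 \<sigma> y} \<noteq> {}" using feasible_exists[of \<sigma> 1] assms by auto
    fix y assume "y \<in> {y. feasible 1 \<sigma> y}"
    then show "\<epsilon> * delay_ratio (1 + \<epsilon>) \<sigma> x i \<le> delay_factor 1 \<sigma> y"
      using completion_time_bound[OF assms(4), of y] slack assms(1)
      by (simp add: delay_ratio_def slack_def pos_divide_le_eq)
  qed
  then show ?thesis using assms(1) by (simp add: field_simps)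
qed

text \<open>By \<open>speed_competitive_imp_ge_1\<close> the ratio \<open>1 / \<epsilon>\<close> is
  impossible for \<epsilon> > 1, hence the maximum with 1. The second conjunct keeps the factor
  \<open>1 / \<epsilon>\<close> for the delay ratio of each request, for every \<epsilon>.\<close>

theorem theorem2p3:
  fixes \<epsilon> :: real
  assumes "\<epsilon> > 0"
  shows "speed_competitive (1 + \<epsilon>) (max 1 (1 / \<epsilon>)) SSF \<and>
    (\<forall>\<sigma> x i. valid_sequence \<sigma> \<and> SSF (1 + \<epsilon>) \<sigma> x \<and> i < length \<sigma> \<longrightarrow>
       delay_ratio (1 + \<epsilon>) \<sigma> x i \<le> 1 / \<epsilon> * opt_delay_factor \<sigma>)"
proof (intro conjI allI impI; (elim conjE)?)
  show "speed_competitive (1 + \<epsilon>) (max 1 (1 / \<epsilon>)) SSF"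
    unfolding speed_competitive_def
  proof (intro allI impI conjI)
    fix \<sigma> assume valid: "valid_sequence \<sigma>"
    show "\<exists>x. SSF (1 + \<epsilon>) \<sigma> x" using SSF_exists[OF valid] assms by simp
    fix x assume x: "SSF (1 + \<epsilon>) \<sigma> x"
    show "feasible (1 + \<epsilon>) \<sigma> x"
      using valid x assms by (intro SSF_schedule.feasible) (simp add: SSF_schedule_def)
    have opt: "1 \<le> opt_delay_factor \<sigma>" by (rule opt_delay_factor_ge_1[OF valid])
    \<comment> \<open>This accounts for the constant 1 inserted into the maximum that defines
      \<open>delay_factor\<close>.\<close>
    have "1 * 1 \<le> max 1 (1 / \<epsilon>) * opt_delay_factor \<sigma>"
      using opt by (intro mult_mono) auto
    moreover have "delay_ratio (1 + \<epsilon>) \<sigma> x i \<le> max 1 (1 / \<epsilon>) * opt_delay_factor \<sigma>"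
      if "i < length \<sigma>" for i
      using SSF_delay_ratio_le[OF assms valid x that]
        mult_right_mono[of "1 / \<epsilon>" "max 1 (1 / \<epsilon>)" "opt_delay_factor \<sigma>"] opt by simp
    ultimately show "delay_factor (1 + \<epsilon>) \<sigma> x \<le> max 1 (1 / \<epsilon>) * opt_delay_factor \<sigma>"
      unfolding delay_factor_def by (intro Max.boundedI) auto
  qed
qed (rule SSF_delay_ratio_le[OF assms])

end
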